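(* Let $V=(V_t)_{t\ge 0}$ be an $\mathbb{R}^d$-valued progressively measurable process, regular enough that $\phi^u_t$ is measurable for all $u\in S^{d-1}$, $t>0$. Assume that for every $u\in S^{d-1}$, every $t>0$ and every $b\in\mathbb{R}\cup\{\pm\infty\}$ we have $\mathbb{P}(\phi^u_t=b)=0$. Assume also that for any $u\in S^{d-1}$ there is some $b_u^*\in\mathbb{R}\cup\{\infty\}$ such that $\mathcal{T}_u(b)<\infty$ for all $b\in(-\infty,b_u^* )$, with $\mathcal{T}_u(b)=\infty$ for all real $b\ge b_u^*$. Then $\mathcal{T}_u(\cdot)$ is continuous and monotone non-decreasing on $(-\infty,b_u^* )$, with $\lim_{b\to-\infty}\mathcal{T}_u(b)=0$ and $\lim_{b\to b_u^*}\mathcal{T}_u(b)=\infty$.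
   Context: Fix $d\ge1$, $S^{d-1}=\{v\in\mathbb{R}^d:\|v\|=1\}$ (Euclidean norm, inner product $\langle\cdot,\cdot\rangle$). For $u\in S^{d-1}$, $b\in\mathbb{R}$, let $\Pi^+(u,b)=\{v\in\mathbb{R}^d:\langle u,v\rangle\ge b\}$. For a set $A\subseteq\mathbb{R}^d$ the hitting time is $\tau_A=\inf\{t\ge0:V_t\in A\}$, with $\inf\emptyset=+\infty$; hitting times are taken to be random variables. Define $\mathcal{T}_u(b)=\mathbb{E}[\tau_{\Pi^+(u,b)}]\in[0,\infty]$ and $\phi^u_t=\sup_{s\in[0,t]}\langle V_s,u\rangle$ (extended-real-valued). The regularity making $\phi^u_t$ measurable is not further specified; for instance càdlàg paths, or a discrete model for $V$, may be assumed. *)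

theory Defs
  imports "HOL-Probability.Probability"
begin

text \<open>
  Processes are functions \<open>V :: real \<Rightarrow> 'w \<Rightarrow> 'v\<close> of which only the times \<open>t \<ge> 0\<close> are used.
  The library locale \<open>filtration\<close> would also constrain the negative times of an index type
  \<open>real\<close>, so filtrations are described here on the index set \<open>[0,\<infinity>)\<close> only.
\<close>

definition filtration_on_nonneg :: "'w measure \<Rightarrow> (real \<Rightarrow> 'w measure) \<Rightarrow> bool" where
  "filtration_on_nonneg M F \<longleftrightarrow>
     (\<forall>t\<ge>0. subalgebra M (F t)) \<and> (\<forall>s t. 0 \<le> s \<longrightarrow> s \<le> t \<longrightarrow> subalgebra (F t) (F s))"

definition progressively_measurable ::
    "(real \<Rightarrow> 'w measure) \<Rightarrow> (real \<Rightarrow> 'w \<Rightarrow> 'v::topological_space) \<Rightarrow> bool" where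
  "progressively_measurable F V \<longleftrightarrow>
     (\<forall>t\<ge>0. (\<lambda>(s, \<omega>). V s \<omega>) \<in> borel_measurable (restrict_space borel {0..t} \<Otimes>\<^sub>M F t))"

definition upper_halfspace :: "'v::real_inner \<Rightarrow> real \<Rightarrow> 'v set" where
  "upper_halfspace u b = {v. u \<bullet> v \<ge> b}"

text \<open>In \<open>ennreal\<close> the infimum of the empty set is \<open>\<infinity>\<close>.\<close>

definition hitting_time :: "(real \<Rightarrow> 'w \<Rightarrow> 'v) \<Rightarrow> 'v set \<Rightarrow> 'w \<Rightarrow> ennreal" where
  "hitting_time V A \<omega> = Inf {ennreal t | t. t \<ge> 0 \<and> V t \<omega> \<in> A}"

definition mean_hitting_time ::
    "'w measure \<Rightarrow> (real \<Rightarrow> 'w \<Rightarrow> 'v::real_inner) \<Rightarrow> 'v \<Rightarrow> real \<Rightarrow> ennreal" where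
  "mean_hitting_time M V u b = (\<integral>\<^sup>+ \<omega>. hitting_time V (upper_halfspace u b) \<omega> \<partial>M)"

definition running_sup :: "(real \<Rightarrow> 'w \<Rightarrow> 'v::real_inner) \<Rightarrow> 'v \<Rightarrow> real \<Rightarrow> 'w \<Rightarrow> ereal" where
  "running_sup V u t \<omega> = (SUP s\<in>{0..t}. ereal (V s \<omega> \<bullet> u))"

end

theory Submission
  imports Defs
begin

text \<open>
  Fix \<open>u\<close> and a path. The hitting time \<open>\<tau>\<^sub>b\<close> of \<open>\<Pi>\<^sup>+(u,b)\<close> is monotone in \<open>b\<close>, and the
  running supremum \<open>\<phi>\<^sub>t\<close> inverts it up to boundary cases: \<open>\<phi>\<^sub>t > b\<close> forces \<open>\<tau>\<^sub>b \<le> t\<close>, and \<open>\<phi>\<^sub>t < b\<close>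
  forces \<open>\<tau>\<^sub>b \<ge> t\<close>. Hence a jump of \<open>\<tau>\<close> at \<open>b\<close> across a rational time \<open>t\<close> means \<open>\<phi>\<^sub>t = b\<close>, which
  is a null event; so for each fixed \<open>b\<close> almost every path has \<open>\<tau>\<close> continuous at \<open>b\<close>, and
  (taking \<open>b = \<infinity>\<close>) almost every path has \<open>\<tau>\<^sub>c \<rightarrow> \<infinity>\<close> as \<open>c \<rightarrow> \<infinity>\<close>. Below \<open>b\<^sub>u\<^sup>*\<close> dominated convergence
  transfers this to the mean; at \<open>b\<^sub>u\<^sup>*\<close> Fatou's lemma does.
\<close>

text \<open>The limit at \<open>bstar u\<close> is stated along a pullback under
  \<open>ereal\<close>; this lemma reduces it to \<open>at b\<close> or \<open>at_top\<close> on the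
  reals. The witness is the image of a predicate under \<open>f\<close>, whose pullback is the
  predicate itself by injectivity.\<close>

lemma filtercomap_filtermap_inj:
  assumes "inj f"
  shows "filtercomap f (filtermap f F) = F"
  by (rule antisym)
    (auto simp: le_filter_def eventually_filtercomap eventually_filtermap inj_eq[OF assms]
      intro: eventually_mono intro!: exI[of _ "\<lambda>y. \<exists>x. f x = y \<and> _ x"])

text \<open>Fatou's lemma bounds the liminf of the integrals below by the infinite integral of
  \<open>Y\<close>, so liminf and limsup are both \<infinity>.\<close>

lemma nn_integral_tendsto_top:
  assumes meas: "\<And>n. X n \<in> borel_measurable M"
    and conv: "AE \<omega> in M. (\<lambda>n. X n \<omega>) \<longlonglongrightarrow> Y \<omega>"
    and infinite: "(\<integral>\<^sup>+ \<omega>. Y \<omega> \<partial>M) = \<infinity>"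
  shows "(\<lambda>n. \<integral>\<^sup>+ \<omega>. X n \<omega> \<partial>M) \<longlonglongrightarrow> \<infinity>"
proof -
  have "AE \<omega> in M. liminf (\<lambda>n. X n \<omega>) = Y \<omega>"
    using conv by eventually_elim (auto intro: lim_imp_Liminf)
  then have "(\<integral>\<^sup>+ \<omega>. liminf (\<lambda>n. X n \<omega>) \<partial>M) = \<infinity>"
    using infinite nn_integral_cong_AE by metis
  with nn_integral_liminf[of X M] meas
  have liminf: "liminf (\<lambda>n. \<integral>\<^sup>+ \<omega>. X n \<omega> \<partial>M) = \<infinity>"
    by (simp add: top_unique)
  moreover have "limsup (\<lambda>n. \<integral>\<^sup>+ \<omega>. X n \<omega> \<partial>M) = \<infinity>"
    using Liminf_le_Limsup[of sequentially "\<lambda>n. \<integral>\<^sup>+ \<omega>. X n \<omega> \<partial>M"] liminf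
    by (simp add: top_unique)
  ultimately show ?thesis
    by (intro Liminf_eq_Limsup) auto
qed

section \<open>Hitting times of half-spaces along one path\<close>

lemma hitting_time_halfspace_le:
  assumes "0 \<le> s" "b \<le> u \<bullet> V s \<omega>"
  shows "hitting_time V (upper_halfspace u b) \<omega> \<le> ennreal s"
  unfolding hitting_time_def upper_halfspace_def
  using assms by (intro Inf_lower) auto

lemma hitting_time_halfspace_mono:
  assumes "a \<le> b"
  shows "hitting_time V (upper_halfspace u a) \<omega> \<le> hitting_time V (upper_halfspace u b) \<omega>"
  unfolding hitting_time_def upper_halfspace_def
  using assms by (intro Inf_superset_mono) auto

text \<open>A supremum strictly above \<open>b\<close> is witnessed by an actual time in
  \<open>{0..t}\<close>; with mere equality it might not be attained.\<close>

lemma hitting_time_le_of_less_running_sup: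
  assumes "ereal b < running_sup V u t \<omega>"
  shows "hitting_time V (upper_halfspace u b) \<omega> \<le> ennreal t"
proof -
  obtain s where s: "s \<in> {0..t}" "ereal b < ereal (V s \<omega> \<bullet> u)"
    using assms unfolding running_sup_def less_SUP_iff by blast
  then have "hitting_time V (upper_halfspace u b) \<omega> \<le> ennreal s"
    by (intro hitting_time_halfspace_le) (auto simp: inner_commute)
  also have "\<dots> \<le> ennreal t"
    using s by (intro ennreal_leI) auto
  finally show ?thesis .
qed

lemma hitting_time_ge_of_running_sup_less:
  assumes "running_sup V u t \<omega> < ereal b"
  shows "ennreal t \<le> hitting_time V (upper_halfspace u b) \<omega>"
  unfolding hitting_time_def
proof (rule Inf_greatest)
  fix x assume "x \<in> {ennreal s | s. s \<ge> 0 \<and> V s \<omega> \<in> upper_halfspace u b}"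
  then obtain s where s: "x = ennreal s" "s \<ge> 0" "u \<bullet> V s \<omega> \<ge> b"
    by (auto simp: upper_halfspace_def)
  have "t \<le> s"
  proof (rule ccontr)
    assume "\<not> t \<le> s"
    then have "ereal (V s \<omega> \<bullet> u) \<le> running_sup V u t \<omega>"
      using s unfolding running_sup_def by (intro SUP_upper) auto
    then have "ereal (V s \<omega> \<bullet> u) < ereal b"
      using assms by (rule le_less_trans)
    then show False
      using s by (simp add: inner_commute)
  qed
  then show "ennreal t \<le> x"
    using s by (simp add: ennreal_leI)
qed

text \<open>Rational times keep the union of exceptional events countable; positivity matches the
  no-atom hypothesis, which covers only t > 0.\<close>

lemma ennreal_obtain_rat_between:
  fixes x y :: ennreal
  assumes "x < y"
  obtains r :: rat where "0 < r" "x < ennreal (real_of_rat r)" "ennreal (real_of_rat r) < y"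
proof -
  obtain r :: rat where r: "x < ennreal (real_of_rat r)" "ennreal (real_of_rat r) < y"
    using ennreal_rat_dense[OF assms] by blast
  from r(1) have "0 < ennreal (real_of_rat r)"
    by (rule le_less_trans[OF zero_le])
  then have "0 < r"
    by (simp add: ennreal_less_zero_iff)
  with r show ?thesis
    using that by blast
qed

lemma hitting_time_halfspace_tendsto:
  assumes no_atom: "\<And>r::rat. 0 < r \<Longrightarrow> running_sup V u (real_of_rat r) \<omega> \<noteq> ereal b"
  shows "((\<lambda>c. hitting_time V (upper_halfspace u c) \<omega>) \<longlongrightarrow>
           hitting_time V (upper_halfspace u b) \<omega>) (nhds b)"
proof (rule order_tendstoI)
  fix a assume "a < hitting_time V (upper_halfspace u b) \<omega>"
  then obtain r :: rat where r: "0 < r" "a < ennreal (real_of_rat r)"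
      "ennreal (real_of_rat r) < hitting_time V (upper_halfspace u b) \<omega>"
    by (rule ennreal_obtain_rat_between)
  then have "\<not> ereal b < running_sup V u (real_of_rat r) \<omega>"
    using hitting_time_le_of_less_running_sup[of b V u "real_of_rat r" \<omega>] by auto
  with no_atom[OF r(1)] have "running_sup V u (real_of_rat r) \<omega> < ereal b"
    by auto
  \<comment> \<open>The time \<open>r\<close> stays fixed while the level moves: a strict inequality
    at \<open>b\<close> persists for all nearby \<open>c\<close>, on both sides.\<close>
  then have "\<forall>\<^sub>F c in nhds b. running_sup V u (real_of_rat r) \<omega> < ereal c"
    by (intro order_tendstoD(1)[of ereal "ereal b"]) (auto intro: tendsto_intros filterlim_ident)
  then show "\<forall>\<^sub>F c in nhds b. a < hitting_time V (upper_halfspace u c) \<omega>"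
    by eventually_elim
      (use r(2) in \<open>blast intro: less_le_trans hitting_time_ge_of_running_sup_less\<close>)
next
  fix a assume "hitting_time V (upper_halfspace u b) \<omega> < a"
  then obtain r :: rat where r: "0 < r" "ennreal (real_of_rat r) < a"
      "hitting_time V (upper_halfspace u b) \<omega> < ennreal (real_of_rat r)"
    using ennreal_obtain_rat_between by metis
  then have "\<not> running_sup V u (real_of_rat r) \<omega> < ereal b"
    using hitting_time_ge_of_running_sup_less[of V u "real_of_rat r" \<omega> b] by auto
  with no_atom[OF r(1)] have "ereal b < running_sup V u (real_of_rat r) \<omega>"
    by auto
  then have "\<forall>\<^sub>F c in nhds b. ereal c < running_sup V u (real_of_rat r) \<omega>"
    by (intro order_tendstoD(2)[of ereal "ereal b"]) (auto intro: tendsto_intros filterlim_ident)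
  then show "\<forall>\<^sub>F c in nhds b. hitting_time V (upper_halfspace u c) \<omega> < a"
    by eventually_elim
      (use r(2) in \<open>blast intro: le_less_trans hitting_time_le_of_less_running_sup\<close>)
qed

text \<open>A finite running supremum at time \<open>r\<close> keeps every sufficiently high level
  from being hit before \<open>r\<close>, and \<open>r\<close> can be chosen arbitrarily
  large.\<close>

lemma hitting_time_halfspace_at_top:
  assumes no_atom: "\<And>r::rat. 0 < r \<Longrightarrow> running_sup V u (real_of_rat r) \<omega> \<noteq> \<infinity>"
  shows "((\<lambda>c. hitting_time V (upper_halfspace u c) \<omega>) \<longlongrightarrow> \<infinity>) at_top"
proof (rule order_tendstoI)
  fix a :: ennreal assume "a < \<infinity>"
  then obtain r :: rat where r: "0 < r" "a < ennreal (real_of_rat r)"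
    by (rule ennreal_obtain_rat_between)
  obtain K where K: "running_sup V u (real_of_rat r) \<omega> < ereal K"
    using no_atom[OF r(1)] less_PInf_Ex_of_nat by (metis ereal_infty_less(1))
  have "a < hitting_time V (upper_halfspace u c) \<omega>" if "K \<le> c" for c
    using r(2) hitting_time_ge_of_running_sup_less[OF K] hitting_time_halfspace_mono[OF that]
    by (meson less_le_trans)
  then show "\<forall>\<^sub>F c in at_top. a < hitting_time V (upper_halfspace u c) \<omega>"
    using eventually_at_top_linorder by blast
qed auto

text \<open>Levels at or below the starting value are hit at time 0, so the limit holds on every
  path, without an exceptional set.\<close>

lemma hitting_time_halfspace_at_bot:
  "((\<lambda>c. hitting_time V (upper_halfspace u c) \<omega>) \<longlongrightarrow> 0) at_bot"
proof (rule tendsto_eventually)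
  have "hitting_time V (upper_halfspace u c) \<omega> = 0" if "c \<le> u \<bullet> V 0 \<omega>" for c
    using hitting_time_halfspace_le[of 0 c u V \<omega>] that by simp
  then show "\<forall>\<^sub>F c in at_bot. hitting_time V (upper_halfspace u c) \<omega> = 0"
    using eventually_at_bot_linorder by blast
qed

section \<open>Mean hitting times\<close>

lemma mean_hitting_time_mono:
  "a \<le> b \<Longrightarrow> mean_hitting_time M V u a \<le> mean_hitting_time M V u b"
  unfolding mean_hitting_time_def by (intro nn_integral_mono hitting_time_halfspace_mono)

lemma mean_hitting_time_dominated_convergence:
  fixes c :: "nat \<Rightarrow> real"
  assumes meas: "\<And>b. hitting_time V (upper_halfspace u b) \<in> borel_measurable M"
    and limit_meas: "Y \<in> borel_measurable M"
    and finite: "mean_hitting_time M V u K < \<infinity>"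
    and bound: "\<forall>\<^sub>F n in sequentially. c n \<le> K"
    and conv: "AE \<omega> in M. (\<lambda>n. hitting_time V (upper_halfspace u (c n)) \<omega>) \<longlonglongrightarrow> Y \<omega>"
  shows "(\<lambda>n. mean_hitting_time M V u (c n)) \<longlonglongrightarrow> (\<integral>\<^sup>+ \<omega>. Y \<omega> \<partial>M)"
proof -
  obtain N where N: "\<And>n. N \<le> n \<Longrightarrow> c n \<le> K"
    using bound unfolding eventually_sequentially by blast
  \<comment> \<open>Shifting by \<open>N\<close> makes the hitting time at level \<open>K\<close> a
    dominating function for every index.\<close>
  have "(\<lambda>n. \<integral>\<^sup>+ \<omega>. hitting_time V (upper_halfspace u (c (n + N))) \<omega> \<partial>M)
          \<longlonglongrightarrow> (\<integral>\<^sup>+ \<omega>. Y \<omega> \<partial>M)"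
  proof (rule nn_integral_dominated_convergence)
    show "(\<integral>\<^sup>+ \<omega>. hitting_time V (upper_halfspace u K) \<omega> \<partial>M) < \<infinity>"
      using finite by (simp add: mean_hitting_time_def)
    show "AE \<omega> in M. hitting_time V (upper_halfspace u (c (n + N))) \<omega>
            \<le> hitting_time V (upper_halfspace u K) \<omega>" for n
      using N[of "n + N"] by (intro AE_I2 hitting_time_halfspace_mono) simp
    show "AE \<omega> in M. (\<lambda>n. hitting_time V (upper_halfspace u (c (n + N))) \<omega>) \<longlonglongrightarrow> Y \<omega>"
      using conv by eventually_elim (rule LIMSEQ_ignore_initial_segment)
  qed (use meas limit_meas in auto)
  then show ?thesis
    unfolding mean_hitting_time_def[symmetric] by (rule LIMSEQ_offset)
qed

text \<open>For a fixed \<open>b\<close>, countably many null events, one per positive rational, are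
  discarded together. The exceptional set may depend on \<open>b\<close>.\<close>

lemma AE_running_sup_neq:
  fixes b :: ereal
  assumes "prob_space M"
    and meas: "\<And>t. t > 0 \<Longrightarrow> running_sup V u t \<in> borel_measurable M"
    and no_atoms: "\<And>t. t > 0 \<Longrightarrow> \<P>(\<omega> in M. running_sup V u t \<omega> = b) = 0"
  shows "AE \<omega> in M. \<forall>r::rat. 0 < r \<longrightarrow> running_sup V u (real_of_rat r) \<omega> \<noteq> b"
  unfolding AE_all_countable
proof
  fix r :: rat
  interpret prob_space M by fact
  show "AE \<omega> in M. 0 < r \<longrightarrow> running_sup V u (real_of_rat r) \<omega> \<noteq> b"
  proof (cases "0 < r")
    case True
    then have "0 < real_of_rat r" by simp
    note [measurable] = meas[OF this]
    have "{\<omega> \<in> space M. running_sup V u (real_of_rat r) \<omega> = b} \<in> events"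
      by measurable
    then have "AE \<omega> in M. \<omega> \<notin> {\<omega> \<in> space M. running_sup V u (real_of_rat r) \<omega> = b}"
      using no_atoms[OF \<open>0 < real_of_rat r\<close>] prob_eq_0 by blast
    then show ?thesis
      by (auto elim: AE_mp)
  qed simp
qed

theorem proposition5p4:
  fixes M :: "'w measure"
    and F :: "real \<Rightarrow> 'w measure"
    and V :: "real \<Rightarrow> 'w \<Rightarrow> real ^ 'd"
    and bstar :: "real ^ 'd \<Rightarrow> ereal"
  assumes "prob_space M"
    and "filtration_on_nonneg M F"
    and "progressively_measurable F V"
    and hitting_time_measurable:
      "\<And>u b. u \<in> sphere 0 1 \<Longrightarrow> hitting_time V (upper_halfspace u b) \<in> borel_measurable M"
    and running_sup_measurable:
      "\<And>u t. u \<in> sphere 0 1 \<Longrightarrow> t > 0 \<Longrightarrow> running_sup V u t \<in> borel_measurable M"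
    and running_sup_no_atoms:
      "\<And>u t (b :: ereal). u \<in> sphere 0 1 \<Longrightarrow> t > 0 \<Longrightarrow> \<P>(\<omega> in M. running_sup V u t \<omega> = b) = 0"
    and bstar_not_minus_infinity: "\<And>u. u \<in> sphere 0 1 \<Longrightarrow> bstar u \<noteq> -\<infinity>"
    and finite_below_bstar:
      "\<And>u b. u \<in> sphere 0 1 \<Longrightarrow> ereal b < bstar u \<Longrightarrow> mean_hitting_time M V u b < \<infinity>"
    and infinite_from_bstar:
      "\<And>u b. u \<in> sphere 0 1 \<Longrightarrow> bstar u \<le> ereal b \<Longrightarrow> mean_hitting_time M V u b = \<infinity>"
  shows "\<forall>u \<in> sphere 0 1.
      continuous_on {b. ereal b < bstar u} (mean_hitting_time M V u) \<and>
      mono_on {b. ereal b < bstar u} (mean_hitting_time M V u) \<and>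
      (mean_hitting_time M V u \<longlongrightarrow> 0) at_bot \<and>
      (mean_hitting_time M V u \<longlongrightarrow> \<infinity>) (filtercomap ereal (at (bstar u)))"
proof
  fix u :: "real ^ 'd" assume u: "u \<in> sphere 0 1"
  let ?T = "mean_hitting_time M V u"
  let ?\<tau> = "\<lambda>b. hitting_time V (upper_halfspace u b)"
  note meas = hitting_time_measurable[OF u]
  have AE_neq: "AE \<omega> in M. \<forall>r::rat. 0 < r \<longrightarrow> running_sup V u (real_of_rat r) \<omega> \<noteq> b"
    for b :: ereal
    using \<open>prob_space M\<close> running_sup_measurable[OF u] running_sup_no_atoms[OF u]
    by (rule AE_running_sup_neq)
  have AE_cont: "AE \<omega> in M. ((\<lambda>c. ?\<tau> c \<omega>) \<longlongrightarrow> ?\<tau> b \<omega>) (nhds b)" for b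
    using AE_neq[of "ereal b"] by eventually_elim (auto intro: hitting_time_halfspace_tendsto)
  have AE_seq: "AE \<omega> in M. (\<lambda>n. ?\<tau> (X n) \<omega>) \<longlonglongrightarrow> ?\<tau> b \<omega>" if "X \<longlonglongrightarrow> b" for X b
    using AE_cont[of b] by eventually_elim (rule filterlim_compose[OF _ that])
  have "(?T \<longlongrightarrow> ?T b) (at b)" if "ereal b < bstar u" for b
    unfolding tendsto_at_iff_sequentially comp_def
  proof (intro allI impI)
    fix X assume X: "X \<longlonglongrightarrow> b"
    \<comment> \<open>A level strictly between \<open>b\<close> and \<open>bstar u\<close>
      eventually dominates sequences approaching \<open>b\<close> from either side and still has
      finite mean.\<close>
    obtain K where K: "b < K" "ereal K < bstar u"
      using ereal_dense2[OF \<open>ereal b < bstar u\<close>] by auto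
    have "\<forall>\<^sub>F n in sequentially. X n \<le> K"
      using order_tendstoD(2)[OF X K(1)] by eventually_elim simp
    with mean_hitting_time_dominated_convergence[OF meas meas finite_below_bstar[OF u K(2)] _
        AE_seq[OF X]]
    show "(\<lambda>n. ?T (X n)) \<longlonglongrightarrow> ?T b"
      by (simp add: mean_hitting_time_def)
  qed
  then have cont: "continuous_on {b. ereal b < bstar u} ?T"
    by (intro continuous_at_imp_continuous_on) (auto simp: isCont_def)
  have mono: "mono_on {b. ereal b < bstar u} ?T"
    by (auto intro!: mono_onI mean_hitting_time_mono)
  have bot: "(?T \<longlongrightarrow> 0) at_bot"
  proof (rule tendsto_at_botI_sequentially)
    fix X :: "nat \<Rightarrow> real" assume X: "filterlim X at_bot sequentially"
    \<comment> \<open>Excluding -\<infinity> provides a level \<open>K\<close> of finite mean to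
      dominate with.\<close>
    have "-\<infinity> < bstar u"
      using bstar_not_minus_infinity[OF u] by (cases "bstar u") auto
    then obtain K where K: "ereal K < bstar u"
      using ereal_dense2 by blast
    have "\<forall>\<^sub>F n in sequentially. X n \<le> K"
      using X by (auto simp: filterlim_at_bot)
    moreover have "AE \<omega> in M. (\<lambda>n. ?\<tau> (X n) \<omega>) \<longlonglongrightarrow> 0"
      by (intro AE_I2 filterlim_compose[OF hitting_time_halfspace_at_bot X])
    ultimately show "(\<lambda>n. ?T (X n)) \<longlonglongrightarrow> 0"
      using mean_hitting_time_dominated_convergence[OF meas _ finite_below_bstar[OF u K],
          of "\<lambda>_. 0" X] by simp
  qed
  have "(?T \<longlongrightarrow> \<infinity>) (filtercomap ereal (at (bstar u)))"
  proof (cases "bstar u")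
    case (real b)
    \<comment> \<open>The limit is two-sided: the Fatou argument works for every sequence tending to
      \<open>b\<close>, because the mean at \<open>b\<close> itself is infinite.\<close>
    have "(?T \<longlongrightarrow> \<infinity>) (at b)"
      unfolding tendsto_at_iff_sequentially comp_def
    proof (intro allI impI)
      fix X assume X: "X \<longlonglongrightarrow> b"
      have "(\<integral>\<^sup>+ \<omega>. ?\<tau> b \<omega> \<partial>M) = \<infinity>"
        using infinite_from_bstar[OF u, of b] real by (simp add: mean_hitting_time_def)
      then show "(\<lambda>n. ?T (X n)) \<longlonglongrightarrow> \<infinity>"
        unfolding mean_hitting_time_def
        by (rule nn_integral_tendsto_top[OF meas AE_seq[OF X]])
    qed
    then show ?thesis
      by (simp add: real at_ereal filtercomap_filtermap_inj)
  next
    case PInf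
    have "(?T \<longlongrightarrow> \<infinity>) at_top"
    proof (rule tendsto_at_topI_sequentially)
      fix X :: "nat \<Rightarrow> real" assume X: "filterlim X at_top sequentially"
      have AE_top: "AE \<omega> in M. (\<lambda>n. ?\<tau> (X n) \<omega>) \<longlonglongrightarrow> \<infinity>"
        using AE_neq[of \<infinity>]
        by eventually_elim
          (auto intro!: filterlim_compose[OF hitting_time_halfspace_at_top X, simplified])
      \<comment> \<open>The total mass 1 is nonzero, so the constant limit \<infinity> has infinite
        integral.\<close>
      have "(\<integral>\<^sup>+ \<omega>. \<infinity> \<partial>M) = \<infinity>"
        using prob_space.emeasure_space_1[OF \<open>prob_space M\<close>] by simp
      then show "(\<lambda>n. ?T (X n)) \<longlonglongrightarrow> \<infinity>"
        unfolding mean_hitting_time_def by (rule nn_integral_tendsto_top[OF meas AE_top])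
    qed
    then show ?thesis
      by (simp add: PInf at_infty_ereal_eq_at_top filtercomap_filtermap_inj)
  next
    case MInf
    then show ?thesis
      using bstar_not_minus_infinity[OF u] by simp
  qed
  with cont mono bot
  show "continuous_on {b. ereal b < bstar u} ?T \<and> mono_on {b. ereal b < bstar u} ?T \<and>
      (?T \<longlongrightarrow> 0) at_bot \<and> (?T \<longlongrightarrow> \<infinity>) (filtercomap ereal (at (bstar u)))"
    by blast
qed

end
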